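(* If $c\geq 2$ and $k\geq 1$, then $\mathit{fw}(\mathit{alt}(c, 2k))\geq k(c+2)-1$ and $\mathit{fw}(\mathit{alt}(c, 2k+1))\geq k(c+2)+1$.
   Context: A sequence $s$ contains a sequence $u$ if some subsequence of $s$ can be changed into $u$ by a one-to-one renaming of its letters. An $(r,s)$-formation is a concatenation of $s$ permutations of the same set of $r$ distinct letters. The formation width $\mathit{fw}(u)$ is the minimum $s$ such that there exists $r$ for which every $(r,s)$-formation contains $u$. $I_c$ denotes $1\,2\ldots c$, $D_c$ denotes $c\,(c-1)\ldots 1$, and $\mathit{alt}(c,k)$ is the concatenation of $k$ blocks starting with $I_c$ and alternating between $I_c$ and $D_c$ (e.g. $\mathit{alt}(3,3)=123321123$). *)

theory Defs
  imports Main "HOL-Library.Sublist"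
begin

definition contains :: "'a list \<Rightarrow> 'b list \<Rightarrow> bool" where
  "contains s u \<longleftrightarrow> (\<exists>t f. subseq t s \<and> inj_on f (set t) \<and> map f t = u)"

definition is_formation :: "nat \<Rightarrow> nat \<Rightarrow> 'a list \<Rightarrow> bool" where
  "is_formation r s F \<longleftrightarrow>
     (\<exists>A ps. finite A \<and> card A = r \<and> length ps = s \<and>
        (\<forall>p \<in> set ps. distinct p \<and> set p = A) \<and> F = concat ps)"

text \<open>
  Formations are taken over the infinite alphabet of natural numbers, so that
  formations with \<open>r\<close> letters exist for every \<open>r\<close>. The minimum is always attained:
  \<open>s = length u\<close> and \<open>r = card (set u)\<close> are admissible, since one letter of \<open>u\<close> can be
  taken from each permutation.
\<close>

definition fw :: "'b list \<Rightarrow> nat" where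
  "fw u = (LEAST s. \<exists>r. \<forall>F :: nat list. is_formation r s F \<longrightarrow> contains F u)"

definition I_seq :: "nat \<Rightarrow> nat list" where
  "I_seq c = [1..<Suc c]"

definition D_seq :: "nat \<Rightarrow> nat list" where
  "D_seq c = rev [1..<Suc c]"

definition alt :: "nat \<Rightarrow> nat \<Rightarrow> nat list" where
  "alt c k = concat (map (\<lambda>i. if even i then I_seq c else D_seq c) [0..<k])"

end

theory Submission
  imports Defs
begin

text \<open>
  For every \<open>r\<close> take increasing and decreasing permutations of \<open>r\<close> letters in the periodic
  pattern of \<open>c\<close> increasing ones followed by two decreasing ones. A copy of \<open>alt c n\<close> is
  \<open>xs, rev xs, xs, \<dots>\<close> for some list \<open>xs\<close> of \<open>c\<close> distinct letters, and it is embedded greedily: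
  reading the next letter forces a move to the next permutation exactly if the step is not
  monotone in the direction of the current permutation; the repeated letter at a junction of
  two blocks always forces a move. If \<open>xs\<close> has \<open>d\<close> descents, then after \<open>2 * j + 1\<close> blocks at
  least \<open>j * (c + 2) + d\<close> permutations have been left behind: the following junction and the
  \<open>c - 1 - d\<close> descents of \<open>rev xs\<close> exhaust the current run of increasing permutations, and the
  next junction together with one extra move, which is forced either just before or just after
  it, exhausts the two decreasing ones; then the next copy of \<open>xs\<close> costs \<open>d\<close> moves again.
\<close>

subsection \<open>Formation width\<close>

lemma subseq_concat_nth:
  assumes "length ps = length t" "\<And>i. i < length t \<Longrightarrow> t ! i \<in> set (ps ! i)"
  shows "subseq t (concat ps)"
  using assms
proof (induction t ps rule: list_induct2')
  case (4 x xs y ys)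
  have "x \<in> set y" using "4.prems"(2)[of 0] by simp
  then have "subseq [x] y" by (simp add: subseq_singleton_left)
  moreover have "subseq xs (concat ys)"
    using 4 "4.prems"(2)[of "Suc _"] by force
  ultimately show ?case
    using list_emb_append_mono[of "(=)" "[x]" y xs "concat ys"] by simp
qed auto

lemma formation_length_contains:
  assumes "is_formation (card (set u)) (length u) F"
  shows "contains F u"
proof -
  obtain A ps where A: "finite A" "card A = card (set u)" "length ps = length u"
    "\<forall>p \<in> set ps. distinct p \<and> set p = A" "F = concat ps"
    using assms by (auto simp: is_formation_def)
  obtain h where h: "bij_betw h (set u) A"
    using finite_same_card_bij[OF _ A(1)] A(2) by fastforce
  have "subseq (map h u) F"
    unfolding A(5) using A(3,4) h
    by (intro subseq_concat_nth) (auto simp: bij_betw_def)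
  moreover have "inj_on (inv_into (set u) h) (set (map h u))"
    using inj_on_inv_into[of "h ` set u" h "set u"] by simp
  moreover have "map (inv_into (set u) h) (map h u) = u"
    using h by (auto simp: bij_betw_def intro: map_idI)
  ultimately show ?thesis unfolding contains_def
    by (intro exI[of _ "map h u"] exI[of _ "inv_into (set u) h"] conjI)
qed

text \<open>Truncation: the first \<open>fw u\<close> permutations of a formation of
  \<open>n\<close> permutations already form a formation on the same letters, so a formation
  avoiding \<open>u\<close> refutes every width up to \<open>n\<close>.\<close>

lemma fw_greater:
  assumes "\<And>r. \<exists>F :: nat list. is_formation r n F \<and> \<not> contains F u"
  shows "n < fw u"
proof (rule ccontr)
  let ?P = "\<lambda>s. \<exists>r. \<forall>F :: nat list. is_formation r s F \<longrightarrow> contains F u"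
  assume "\<not> n < fw u"
  then have le: "fw u \<le> n" by simp
  \<comment> \<open>Some admissible value must exist before \<open>LEAST\<close> is known to be
    attained.\<close>
  have "?P (length u)" using formation_length_contains by blast
  then have "?P (fw u)" unfolding fw_def by (rule LeastI)
  then obtain r where r: "\<And>F :: nat list. is_formation r (fw u) F \<Longrightarrow> contains F u" by blast
  obtain F :: "nat list" where F: "is_formation r n F" "\<not> contains F u" using assms by blast
  then obtain A ps where A: "finite A" "card A = r" "length ps = n"
    "\<forall>p \<in> set ps. distinct p \<and> set p = A" "F = concat ps"
    by (auto simp: is_formation_def)
  have "is_formation r (fw u) (concat (take (fw u) ps))"
    unfolding is_formation_def using A le
    by (intro exI[of _ A] exI[of _ "take (fw u) ps"]) (auto dest: in_set_takeD)
  then have "contains (concat (take (fw u) ps)) u" by (rule r)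
  then obtain t f where t: "subseq t (concat (take (fw u) ps))" "inj_on f (set t)" "map f t = u"
    by (auto simp: contains_def)
  have "subseq (concat (take (fw u) ps)) F"
    unfolding A(5) by (metis append_take_drop_id concat_append list_emb_prefix subseq_order.refl)
  then have "subseq t F"
    by (rule subseq_order.trans[OF t(1)])
  then have "contains F u"
    unfolding contains_def using t(2,3)
    by (intro exI[of _ t] exI[of _ f] conjI)
  with F(2) show False ..
qed

lemma contains_imp_subseq_map:
  assumes "contains s u"
  obtains a where "inj_on a (set u)" "subseq (map a u) s"
proof -
  obtain t f where t: "subseq t s" "inj_on f (set t)" "map f t = u"
    using assms by (auto simp: contains_def)
  have "map (inv_into (set t) f) u = t"
    using t(2) by (auto simp flip: t(3) intro: map_idI)
  moreover have "inj_on (inv_into (set t) f) (set u)"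
    using inj_on_inv_into[of "set u" f "set t"] by (auto simp flip: t(3))
  ultimately show thesis using that t(1) by metis
qed

subsection \<open>Greedy embedding\<close>

text \<open>Both comparisons are strict, so a repeated letter always moves on: a permutation holds
  each letter only once.\<close>

definition greedy_step :: "(nat \<Rightarrow> bool) \<Rightarrow> nat \<Rightarrow> 'a::linorder \<Rightarrow> 'a \<Rightarrow> nat" where
  "greedy_step T p x y = (if (if T p then x < y else y < x) then p else Suc p)"

text \<open>
  \<open>greedy T p xs\<close> is the index of the permutation reached after reading \<open>xs\<close>, when the first
  letter of \<open>xs\<close> is taken from permutation \<open>p\<close>; here \<open>T q\<close> says that permutation \<open>q\<close> is increasing.
\<close>

fun greedy :: "(nat \<Rightarrow> bool) \<Rightarrow> nat \<Rightarrow> 'a::linorder list \<Rightarrow> nat" where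
  "greedy T p (x # y # zs) = greedy T (greedy_step T p x y) (y # zs)"
| "greedy T p [x] = p"
| "greedy T p [] = p"

fun descents :: "'a::linorder list \<Rightarrow> nat" where
  "descents (x # y # zs) = of_bool (y < x) + descents (y # zs)"
| "descents [x] = 0"
| "descents [] = 0"

lemma greedy_step_ge: "p \<le> greedy_step T p x y"
  and greedy_step_le: "greedy_step T p x y \<le> Suc p"
  and greedy_step_eq [simp]: "greedy_step T p x x = Suc p"
  by (auto simp: greedy_step_def)

text \<open>A step from \<open>p < q\<close> reaches at most \<open>Suc p\<close>, hence at most
  \<open>q\<close>.\<close>

lemma greedy_step_mono: "p \<le> q \<Longrightarrow> greedy_step T p x y \<le> greedy_step T q x y"
  by (cases "p = q") (auto simp: greedy_step_def)

lemma greedy_ge: "p \<le> greedy T p xs"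
  by (induction T p xs rule: greedy.induct) (auto intro: order_trans[OF greedy_step_ge])

lemma greedy_mono: "p \<le> q \<Longrightarrow> greedy T p xs \<le> greedy T q xs"
  by (induction T p xs arbitrary: q rule: greedy.induct) (auto simp: greedy_step_mono)

lemma greedy_append: "greedy T p (xs @ a # ys) = greedy T (greedy T p (xs @ [a])) (a # ys)"
proof (induction xs arbitrary: p)
  case (Cons x xs)
  then show ?case by (cases xs) auto
qed auto

lemma greedy_append_last:
  assumes "xs \<noteq> []"
  shows "greedy T p (xs @ ys) = greedy T (greedy T p xs) (last xs # ys)"
  using greedy_append[of T p "butlast xs" "last xs" ys] assms
  by (metis append.assoc append_Cons append_Nil append_butlast_last_id)

lemma greedy_monotone:
  assumes "sorted_wrt (\<lambda>x y. if T p then x < y else y < x) xs"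
  shows "greedy T p xs = p"
  using assms by (induction xs rule: induct_list012) (auto simp: greedy_step_def)

lemma sorted_wrt_subseq: "subseq xs ys \<Longrightarrow> sorted_wrt P ys \<Longrightarrow> sorted_wrt P xs"
  by (induction rule: list_emb.induct) (auto dest: list_emb_set)

text \<open>Greedy is optimal. Split \<open>t\<close> at the part \<open>us\<close> taken from
  permutation \<open>s\<close>: greedy stays at \<open>s\<close> on \<open>us\<close> and enters the
  rest no later than \<open>Suc s\<close>, so monotonicity in the start index reduces to the
  induction hypothesis.\<close>

lemma greedy_less:
  assumes "sorted_wrt (<) xs" "t \<noteq> []"
    and "subseq t (concat (map (\<lambda>p. if T p then xs else rev xs) [s..<n]))"
  shows "greedy T s t < n"
  using assms(2,3)
proof (induction "n - s" arbitrary: s t)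
  case 0
  then show ?case by simp
next
  case (Suc m)
  let ?f = "\<lambda>p. if T p then xs else rev xs"
  have s: "s < n" using Suc.hyps(2) by simp
  then have "subseq t (?f s @ concat (map ?f [Suc s..<n]))"
    using Suc.prems(2) by (simp add: upt_conv_Cons)
  then obtain us vs where t: "t = us @ vs" "subseq us (?f s)"
    "subseq vs (concat (map ?f [Suc s..<n]))"
    by (elim subseq_appendE) blast
  have IH: "greedy T (Suc s) vs < n" if "vs \<noteq> []"
    using Suc.hyps that t(3) by simp
  show ?case
  proof (cases "us = []")
    case True
    then show ?thesis
      using IH Suc.prems(1) t(1) le_less_trans[OF greedy_mono[of s "Suc s"]] by simp
  next
    case us: False
    have "sorted_wrt (\<lambda>x y. if T s then x < y else y < x) (?f s)"
      using assms(1) by (simp add: sorted_wrt_rev)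
    with t(2) have "sorted_wrt (\<lambda>x y. if T s then x < y else y < x) us"
      by (rule sorted_wrt_subseq)
    then have "greedy T s us = s" by (rule greedy_monotone)
    then have *: "greedy T s t = greedy T s (last us # vs)"
      unfolding t(1) greedy_append_last[OF us] by simp
    show ?thesis
    proof (cases vs)
      case Nil
      then show ?thesis using * s by simp
    next
      case (Cons v vs')
      then show ?thesis
        using * IH le_less_trans[OF greedy_mono[OF greedy_step_le]] by simp
    qed
  qed
qed

lemma descents_append: "descents (xs @ [a, b]) = descents (xs @ [a]) + of_bool (b < a)"
  by (induction xs rule: induct_list012) auto

text \<open>Each adjacent pair is a descent in exactly one reading direction.\<close>

lemma descents_rev:
  "distinct xs \<Longrightarrow> descents xs + descents (rev xs) = length xs - 1"
  by (induction xs rule: induct_list012) (auto simp: descents_append)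

subsection \<open>The periodic formation\<close>

definition incr_phase :: "nat \<Rightarrow> nat \<Rightarrow> bool" where
  "incr_phase c p \<longleftrightarrow> p mod (c + 2) < c"

lemma incr_phase_iff: "i < c + 2 \<Longrightarrow> incr_phase c (m * (c + 2) + i) \<longleftrightarrow> i < c"
  by (simp only: incr_phase_def mod_mult_self3 mod_less)

text \<open>Inside an increasing run every descent costs a move. The \<open>min\<close> stops the
  count at the end of the run, after which descents may be free.\<close>

lemma greedy_incr_phase:
  assumes "m * (c + 2) \<le> p"
  shows "min (p + descents xs) (m * (c + 2) + c) \<le> greedy (incr_phase c) p xs"
  using assms
proof (induction "incr_phase c" p xs rule: greedy.induct)
  case (1 p x y zs)
  let ?q = "greedy_step (incr_phase c) p x y"
  show ?case
  proof (cases "p < m * (c + 2) + c")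
    case True
    then have "incr_phase c p"
      using incr_phase_iff[of "p - m * (c + 2)" c m] "1.prems" by simp
    then have "p + of_bool (y < x) \<le> ?q" by (auto simp: greedy_step_def)
    moreover have "min (?q + descents (y # zs)) (m * (c + 2) + c)
        \<le> greedy (incr_phase c) p (x # y # zs)"
      using 1 greedy_step_ge[of p "incr_phase c" x y] by simp
    ultimately show ?thesis by simp
  next
    case False
    then show ?thesis
      using greedy_ge[of p "incr_phase c" "x # y # zs"] by simp
  qed
qed auto

lemma greedy_step_decr_phase:
  assumes "m * (c + 2) + c + i \<le> p" "i < 2" "x < y"
  shows "m * (c + 2) + c + i + 1 \<le> greedy_step (incr_phase c) p x y"
proof -
  have "\<not> incr_phase c (m * (c + 2) + c + i)"
    using incr_phase_iff[of "c + i" c m] assms(2) by (simp add: add.assoc)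
  then have "m * (c + 2) + c + i + 1 = greedy_step (incr_phase c) (m * (c + 2) + c + i) x y"
    using assms(3) by (simp add: greedy_step_def)
  then show ?thesis using greedy_step_mono[OF assms(1)] by metis
qed

context
  fixes xs :: "'a::linorder list" and c :: nat
  assumes distinct_xs: "distinct xs" and length_xs: "length xs = c" and c_ge_2: "c \<ge> 2"
begin

lemma greedy_rev_block:
  assumes "m * (c + 2) + descents xs \<le> p"
  shows "m * (c + 2) + c \<le> greedy (incr_phase c) (Suc p) (rev xs)"
proof -
  have "descents xs + descents (rev xs) = c - 1"
    using descents_rev[OF distinct_xs] length_xs by simp
  then show ?thesis
    using greedy_incr_phase[of m c "Suc p" "rev xs"] assms c_ge_2 by simp
qed

text \<open>The pair of first letters of \<open>xs\<close> is read as \<open>a\<close>,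
  \<open>b\<close> before the junction and as \<open>b\<close>, \<open>a\<close> after it. One of
  these is an ascent, and this gives the extra move in the decreasing run.\<close>

lemma greedy_two_blocks:
  assumes "m * (c + 2) + descents xs \<le> p"
  shows "Suc m * (c + 2) + descents xs \<le>
    greedy (incr_phase c) (Suc (greedy (incr_phase c) (Suc p) (rev xs))) xs"
proof -
  obtain b a zs where xs: "xs = b # a # zs"
    using length_xs c_ge_2 by (metis Suc_le_length_iff numeral_2_eq_2)
  let ?G = "greedy (incr_phase c)"
  let ?q = "?G (Suc p) (rev xs)"
  have des: "descents xs + descents (rev xs) = c - 1"
    using descents_rev[OF distinct_xs] length_xs by simp
  have "a \<noteq> b" using distinct_xs xs by auto
  then consider "a < b" | "b < a" by fastforce
  then show ?thesis
  proof cases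
    case 1
    let ?q' = "?G (Suc p) (rev zs @ [a])"
    \<comment> \<open>The last step of \<open>rev xs\<close> is an ascent, so the increasing run is
      exhausted already at \<open>a\<close>; this ascent leaves the first decreasing permutation and
      the junction the second.\<close>
    have "descents (rev xs) = descents (rev zs @ [a])"
      using 1 descents_append[of "rev zs" a b] by (simp add: xs)
    then have "m * (c + 2) + c \<le> ?q'"
      using greedy_incr_phase[of m c "Suc p" "rev zs @ [a]"] assms des c_ge_2 by simp
    moreover have "?q = greedy_step (incr_phase c) ?q' a b"
      using greedy_append[of "incr_phase c" "Suc p" "rev zs" a "[b]"] by (simp add: xs)
    ultimately have "m * (c + 2) + c + 1 \<le> ?q"
      using greedy_step_decr_phase[of m c 0 ?q' a b] 1 by simp
    then have "Suc m * (c + 2) \<le> Suc ?q" by simp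
    then show ?thesis
      using greedy_incr_phase[of "Suc m" c "Suc ?q" xs] des c_ge_2 by simp
  next
    case 2
    let ?q' = "greedy_step (incr_phase c) (Suc ?q) b a"
    \<comment> \<open>Now the junction leaves the first decreasing permutation and the opening
      ascent of \<open>xs\<close> the second; dropping \<open>b\<close> loses no descent.\<close>
    have "m * (c + 2) + c + 1 \<le> Suc ?q"
      using greedy_rev_block[OF assms] by simp
    then have "Suc m * (c + 2) \<le> ?q'"
      using greedy_step_decr_phase[of m c 1 "Suc ?q" b a] 2 by simp
    moreover have "descents xs = descents (a # zs)"
      using 2 by (simp add: xs)
    moreover have "?G (Suc ?q) xs = ?G ?q' (a # zs)"
      by (subst (2) xs) simp
    ultimately show ?thesis
      using greedy_incr_phase[of "Suc m" c ?q' "a # zs"] des c_ge_2 by simp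
  qed
qed

abbreviation blocks :: "nat \<Rightarrow> 'a list" where
  "blocks n \<equiv> concat (map (\<lambda>i. if even i then xs else rev xs) [0..<n])"

lemma greedy_junction:
  assumes "us \<noteq> []" "vs \<noteq> []" "last us = hd vs"
  shows "greedy T p (us @ vs) = greedy T (Suc (greedy T p us)) vs"
  using assms by (cases vs) (auto simp: greedy_append_last)

lemma greedy_odd_blocks:
  "k * (c + 2) + descents xs \<le> greedy (incr_phase c) 0 (blocks (2 * k + 1))"
proof (induction k)
  case 0
  have "descents xs \<le> c - 1"
    using descents_rev[OF distinct_xs] length_xs by simp
  then show ?case
    using greedy_incr_phase[of 0 c 0 xs] by simp
next
  case (Suc k)
  have ne: "xs \<noteq> []" using length_xs c_ge_2 by auto
  have eq: "blocks (2 * Suc k + 1) = (blocks (2 * k + 1) @ rev xs) @ xs"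
    by simp
  have "greedy (incr_phase c) 0 (blocks (2 * Suc k + 1)) =
    greedy (incr_phase c) (Suc (greedy (incr_phase c)
      (Suc (greedy (incr_phase c) 0 (blocks (2 * k + 1)))) (rev xs))) xs"
    unfolding eq using ne
    by (subst greedy_junction, simp, simp, simp add: last_rev)
       (subst greedy_junction, auto simp: hd_rev)
  then show ?case using greedy_two_blocks[OF Suc.IH] by simp
qed

text \<open>The final \<open>rev xs\<close> supplies the complementary descents, so the bound no
  longer depends on \<open>xs\<close>.\<close>

lemma greedy_even_blocks:
  "k * (c + 2) + c \<le> greedy (incr_phase c) 0 (blocks (2 * k + 2))"
proof -
  have ne: "xs \<noteq> []" using length_xs c_ge_2 by auto
  have eq: "blocks (2 * k + 2) = blocks (2 * k + 1) @ rev xs"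
    by simp
  have "greedy (incr_phase c) 0 (blocks (2 * k + 2)) =
    greedy (incr_phase c) (Suc (greedy (incr_phase c) 0 (blocks (2 * k + 1)))) (rev xs)"
    unfolding eq using ne by (subst greedy_junction) (auto simp: hd_rev)
  then show ?thesis using greedy_rev_block[OF greedy_odd_blocks] by simp
qed

end

section \<open>From greedy bounds to the formation width of \<open>alt\<close>\<close>

lemma map_alt:
  "map a (alt c n) =
    concat (map (\<lambda>i. if even i then map a (I_seq c) else rev (map a (I_seq c))) [0..<n])"
  by (auto simp: alt_def map_concat I_seq_def D_seq_def rev_map intro: arg_cong[where f = concat])

text \<open>One pattern \<open>T\<close> serves all \<open>r\<close>: a copy of
  \<open>alt c n\<close> consists of alternating blocks of the distinct list
  \<open>map a (I_seq c)\<close>, and greedy would run past the \<open>m\<close> available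
  permutations.\<close>

lemma fw_alt_greater:
  assumes "c \<ge> 1" "n \<ge> 1"
    and "\<And>xs :: nat list. distinct xs \<Longrightarrow> length xs = c \<Longrightarrow>
      m \<le> greedy T 0 (concat (map (\<lambda>i. if even i then xs else rev xs) [0..<n]))"
  shows "m < fw (alt c n)"
proof (rule fw_greater)
  fix r :: nat
  let ?ps = "map (\<lambda>p. if T p then [0..<r] else rev [0..<r]) [0..<m]"
  have "is_formation r m (concat ?ps)"
    unfolding is_formation_def by (intro exI[of _ "{0..<r}"] exI[of _ ?ps]) auto
  moreover have "\<not> contains (concat ?ps) (alt c n)"
  proof
    assume "contains (concat ?ps) (alt c n)"
    then obtain a where a: "inj_on a (set (alt c n))" "subseq (map a (alt c n)) (concat ?ps)"
      by (rule contains_imp_subseq_map)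
    have "set (I_seq c) \<subseteq> set (alt c n)"
      using assms(2) by (simp add: alt_def upt_conv_Cons)
    then have "inj_on a (set (I_seq c))" using a(1) inj_on_subset by blast
    then have "distinct (map a (I_seq c))" "length (map a (I_seq c)) = c"
      by (auto simp: distinct_map I_seq_def)
    then have "m \<le> greedy T 0 (map a (alt c n))"
      unfolding map_alt by (rule assms(3))
    moreover have "alt c n \<noteq> []"
      using \<open>set (I_seq c) \<subseteq> set (alt c n)\<close> assms(1) by (auto simp: I_seq_def)
    then have "greedy T 0 (map a (alt c n)) < m"
      using a(2) by (intro greedy_less[of "[0..<r]"]) auto
    ultimately show False by simp
  qed
  ultimately show "\<exists>F :: nat list. is_formation r m F \<and> \<not> contains F (alt c n)" by blast
qed

theorem theorem5p6:
  fixes c k :: nat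
  assumes "c \<ge> 2" and "k \<ge> 1"
  shows "fw (alt c (2 * k)) \<ge> k * (c + 2) - 1 \<and>
         fw (alt c (2 * k + 1)) \<ge> k * (c + 2) + 1"
proof
  obtain j where k: "k = Suc j" using assms(2) by (cases k) auto
  \<comment> \<open>Here \<open>j * (c + 2) + c + 1 = k * (c + 2) - 1\<close>.\<close>
  have "j * (c + 2) + c < fw (alt c (2 * j + 2))"
    using assms(1) by (intro fw_alt_greater) (rule greedy_even_blocks | simp)+
  then show "fw (alt c (2 * k)) \<ge> k * (c + 2) - 1"
    by (simp add: k)
  \<comment> \<open>The descents are dropped by \<open>add_leD1\<close>, as an increasing
    \<open>xs\<close> has none.\<close>
  have "k * (c + 2) < fw (alt c (2 * k + 1))"
    using assms(1) by (intro fw_alt_greater) (rule add_leD1, rule greedy_odd_blocks | simp)+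
  then show "fw (alt c (2 * k + 1)) \<ge> k * (c + 2) + 1"
    by simp
qed

end
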